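(* Let $Q\subset\mathbb{R}^n$ be a convex compact set, $L>0$, $\delta>0$, and let $\psi_\delta:Q\times Q\to\mathbb{R}$ be a $(\delta,L)$-model with respect to $V[y](x)$ in the variational-inequality sense defined in the context. Let $(z_k),(w_k),(L_k)$ be generated by the generalized mirror prox method of the context with initial guess $L_0>0$. Put $$S_N=\sum_{k=0}^{N-1}\frac1{L_{k+1}},\qquad \widehat w_N=\frac1{S_N}\sum_{k=0}^{N-1}\frac{w_k}{L_{k+1}}.$$ Then $$\max_{u\in Q}\left(-\frac1{S_N}\sum_{k=0}^{N-1}\frac{\psi_\delta(u,w_k)}{L_{k+1}}\right)\le\frac{2L\max_{u\in Q}V[z_0](u)}{N}+\delta,$$ $$\max_{u\in Q}\psi_\delta(\widehat w_N,u)\le\frac{2L\max_{u\in Q}V[z_0](u)}{N}+2\delta .$$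
   Context: $d$ is a convex differentiable function on $Q$ and $V[y](x)=d(x)-d(y)-\langle\nabla d(y),x-y\rangle$ (strong convexity is not assumed). VI model. $\psi_\delta:Q\times Q\to\mathbb{R}$ is a $(\delta,L)$-model w.r.t. $V[y](x)$ if for all $x,y,z\in Q$: (i) $\psi_\delta(x,y)$ is convex in $x$; (ii) $\psi_\delta(x,x)=0$; (iii) $\psi_\delta(x,y)+\psi_\delta(y,x)\le\delta$; (iv) $\psi_\delta(x,y)\le\psi_\delta(x,z)+\psi_\delta(z,y)+L\,V[z](x)+L\,V[y](z)+\delta$. Generalized mirror prox. Let $z_0=\arg\min_{u\in Q}d(u)$. For $k=0,1,\dots$: find the smallest integer $i_k\ge0$ such that, with $L_{k+1}=2^{i_k-1}L_k$, $$w_k=\arg\min_{x\in Q}\{\psi_\delta(x,z_k)+L_{k+1}V[z_k](x)\},\qquad z_{k+1}=\arg\min_{x\in Q}\{\psi_\delta(x,w_k)+L_{k+1}V[z_k](x)\},$$ one has $$\psi_\delta(z_{k+1},z_k)\le\psi_\delta(z_{k+1},w_k)+\psi_\delta(w_k,z_k)+L_{k+1}\bigl(V[z_k](w_k)+V[w_k](z_{k+1})\bigr)+\delta .$$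
   Formalization: The initial guess is additionally assumed to satisfy L_0 ≤ 4L, since for arbitrary L_0 > 0 the bounds are false (e.g. Q=[0,1], d=x²/2, ψ(x,y)=y−x, L=δ=0.01, L_0=8, N=1); maxima are stated as suprema, with the left-hand functions shown bounded above. *)

theory Defs
  imports "HOL-Analysis.Analysis"
begin

(* The derivative is taken within Q, so Q may have empty interior.  The gradient is then not unique,
   but for convex Q the pairing of g y with x - y does not depend on its choice for x, y in Q. *)
definition has_gradient_on :: "('a::real_inner \<Rightarrow> real) \<Rightarrow> ('a \<Rightarrow> 'a) \<Rightarrow> 'a set \<Rightarrow> bool" where
  "has_gradient_on d g Q \<longleftrightarrow> (\<forall>y\<in>Q. (d has_derivative (\<lambda>h. g y \<bullet> h)) (at y within Q))"

(* Bregman d g y x is written V[y](x): the base point comes first. *)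
definition Bregman :: "('a::real_inner \<Rightarrow> real) \<Rightarrow> ('a \<Rightarrow> 'a) \<Rightarrow> 'a \<Rightarrow> 'a \<Rightarrow> real" where
  "Bregman d g y x = d x - d y - g y \<bullet> (x - y)"

definition vi_model ::
  "'a::real_vector set \<Rightarrow> ('a \<Rightarrow> 'a \<Rightarrow> real) \<Rightarrow> real \<Rightarrow> real \<Rightarrow> ('a \<Rightarrow> 'a \<Rightarrow> real) \<Rightarrow> bool" where
  "vi_model Q V \<delta> L \<psi> \<longleftrightarrow>
     (\<forall>y\<in>Q. convex_on Q (\<lambda>x. \<psi> x y)) \<and>
     (\<forall>x\<in>Q. \<psi> x x = 0) \<and>
     (\<forall>x\<in>Q. \<forall>y\<in>Q. \<psi> x y + \<psi> y x \<le> \<delta>) \<and>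
     (\<forall>x\<in>Q. \<forall>y\<in>Q. \<forall>z\<in>Q. \<psi> x y \<le> \<psi> x z + \<psi> z y + L * V z x + L * V y z + \<delta>)"

definition mirror_prox_step ::
  "'a set \<Rightarrow> ('a \<Rightarrow> 'a \<Rightarrow> real) \<Rightarrow> ('a \<Rightarrow> 'a \<Rightarrow> real) \<Rightarrow> real \<Rightarrow> 'a \<Rightarrow> 'a \<Rightarrow> 'a \<Rightarrow> bool" where
  "mirror_prox_step Q V \<psi> M z w z' \<longleftrightarrow>
     is_arg_min (\<lambda>x. \<psi> x z + M * V z x) (\<lambda>x. x \<in> Q) w \<and>
     is_arg_min (\<lambda>x. \<psi> x w + M * V z x) (\<lambda>x. x \<in> Q) z'"

definition mirror_prox_accept ::
  "('a \<Rightarrow> 'a \<Rightarrow> real) \<Rightarrow> real \<Rightarrow> ('a \<Rightarrow> 'a \<Rightarrow> real) \<Rightarrow> real \<Rightarrow> 'a \<Rightarrow> 'a \<Rightarrow> 'a \<Rightarrow> bool" where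
  "mirror_prox_accept V \<delta> \<psi> M z w z' \<longleftrightarrow>
     \<psi> z' z \<le> \<psi> z' w + \<psi> w z + M * (V z w + V w z') + \<delta>"

(* Without strict convexity the minimizers need not be unique, so i is the smallest successful
   exponent in the sense of the actual search: each smaller exponent j was tried, with some choice
   of minimizers, and failed the test.  For unique minimizers this is the least i passing the test. *)
definition generalized_mirror_prox ::
  "'a set \<Rightarrow> ('a \<Rightarrow> real) \<Rightarrow> ('a \<Rightarrow> 'a \<Rightarrow> real) \<Rightarrow> real \<Rightarrow> ('a \<Rightarrow> 'a \<Rightarrow> real) \<Rightarrow>
   (nat \<Rightarrow> 'a) \<Rightarrow> (nat \<Rightarrow> 'a) \<Rightarrow> (nat \<Rightarrow> real) \<Rightarrow> bool" where
  "generalized_mirror_prox Q d V \<delta> \<psi> z w Ls \<longleftrightarrow>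
     is_arg_min d (\<lambda>u. u \<in> Q) (z 0) \<and>
     (\<forall>k. \<exists>i::nat.
        Ls (Suc k) = 2 powi (int i - 1) * Ls k \<and>
        mirror_prox_step Q V \<psi> (Ls (Suc k)) (z k) (w k) (z (Suc k)) \<and>
        mirror_prox_accept V \<delta> \<psi> (Ls (Suc k)) (z k) (w k) (z (Suc k)) \<and>
        (\<forall>j<i. \<exists>w' z'.
           mirror_prox_step Q V \<psi> (2 powi (int j - 1) * Ls k) (z k) w' z' \<and>
           \<not> mirror_prox_accept V \<delta> \<psi> (2 powi (int j - 1) * Ls k) (z k) w' z'))"

definition weight_sum :: "(nat \<Rightarrow> real) \<Rightarrow> nat \<Rightarrow> real" where
  "weight_sum Ls N = (\<Sum>k<N. 1 / Ls (Suc k))"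

definition weighted_average :: "(nat \<Rightarrow> real) \<Rightarrow> (nat \<Rightarrow> 'a::real_vector) \<Rightarrow> nat \<Rightarrow> 'a" where
  "weighted_average Ls w N = (1 / weight_sum Ls N) *\<^sub>R (\<Sum>k<N. (1 / Ls (Suc k)) *\<^sub>R w k)"

end

theory Submission
  imports Defs
begin

text \<open>
  A minimizer \<open>p\<close> of a convex function plus \<open>M * V z\<close> satisfies a three-point inequality with gain
  \<open>M * V p u\<close>.  Applying it to \<open>w k\<close> (at \<open>u = z (k + 1)\<close>) and to \<open>z (k + 1)\<close> and
  adding the acceptance test gives
  \<open>- \<psi> u (w k) / L\<^sub>k\<^sub>+\<^sub>1 \<le> V (z k) u - V (z (k + 1)) u + \<delta> / L\<^sub>k\<^sub>+\<^sub>1\<close>,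
  which telescopes.  A test can fail only for a constant below \<open>L\<close>, so every accepted constant is
  at most \<open>2 * L\<close> and the weights sum to at least \<open>N / (2 * L)\<close>.
\<close>

text \<open>One-sided first-order condition. It is stated on \<open>{0..1}\<close> because a
  function on \<open>Q\<close> can only be probed along segments that stay inside \<open>Q\<close>,
  starting from the point of interest.\<close>

lemma real_derivative_nonneg_at_min:
  fixes f :: "real \<Rightarrow> real"
  assumes "(f has_real_derivative D) (at 0 within {0..1})"
    and "\<And>t. t \<in> {0..1} \<Longrightarrow> f 0 \<le> f t"
  shows "0 \<le> D"
proof (rule ccontr)
  assume "\<not> 0 \<le> D"
  then obtain e where e: "e > 0" "\<And>h. \<lbrakk>h > 0; 0 + h \<in> {0..1}; h < e\<rbrakk> \<Longrightarrow> f (0 + h) < f 0"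
    using has_real_derivative_neg_dec_right[OF assms(1)] by force
  define h where "h = min 1 (e / 2)"
  have "h > 0" "h \<in> {0..1}" "h < e" using e(1) by (auto simp: h_def)
  then show False using e(2)[of h] assms(2)[of h] by simp
qed

lemma segment_in_convex:
  assumes "convex Q" "p \<in> Q" "u \<in> Q" "t \<in> {0..1::real}"
  shows "p + t *\<^sub>R (u - p) \<in> Q"
  using convexD_alt[OF assms(1-3), of t] assms(4) by (simp add: algebra_simps)

lemma convex_on_segment_le:
  assumes "convex_on Q f" "p \<in> Q" "u \<in> Q" "t \<in> {0..1::real}"
  shows "f (p + t *\<^sub>R (u - p)) \<le> f p + t * (f u - f p)"
proof -
  have "f ((1 - t) *\<^sub>R p + t *\<^sub>R u) \<le> (1 - t) * f p + t * f u"
    using convex_onD[OF assms(1), of t p u] assms by auto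
  moreover have "(1 - t) *\<^sub>R p + t *\<^sub>R u = p + t *\<^sub>R (u - p)" by (simp add: algebra_simps)
  ultimately show ?thesis by (simp add: algebra_simps)
qed

lemma has_gradient_on_segment_derivative:
  assumes "has_gradient_on d g Q" "convex Q" "p \<in> Q" "u \<in> Q"
  shows "((\<lambda>t. d (p + t *\<^sub>R (u - p))) has_real_derivative g p \<bullet> (u - p)) (at 0 within {0..1})"
proof -
  have seg: "((\<lambda>t::real. p + t *\<^sub>R (u - p)) has_derivative (\<lambda>t. t *\<^sub>R (u - p))) (at 0 within {0..1})"
    by (auto intro!: derivative_eq_intros)
  have "(d has_derivative (\<lambda>h. g p \<bullet> h)) (at p within Q)"
    using assms by (auto simp: has_gradient_on_def)
  \<comment> \<open>The base point is written as the segment at parameter 0, the form the chain rule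
    expects; shrinking \<open>Q\<close> to the image of the segment is allowed by convexity.\<close>
  then have "(d has_derivative (\<lambda>h. g p \<bullet> h))
      (at (p + 0 *\<^sub>R (u - p)) within (\<lambda>t. p + t *\<^sub>R (u - p)) ` {0..1})"
    using segment_in_convex[OF assms(2-4)] by (auto intro: has_derivative_subset)
  from has_derivative_in_compose[OF seg this]
  show ?thesis
    by (simp add: has_field_derivative_def mult_commute_abs)
qed

text \<open>The chord of \<open>d\<close> from \<open>y\<close> to \<open>x\<close> lies above
  \<open>d\<close> and meets it at \<open>y\<close>. The gap between them is thus minimal at
  parameter 0, and its one-sided derivative there is the Bregman divergence.\<close>

lemma Bregman_nonneg:
  assumes "convex_on Q d" "has_gradient_on d g Q" "x \<in> Q" "y \<in> Q"
  shows "0 \<le> Bregman d g y x"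
proof -
  have cQ: "convex Q" using assms(1) by (rule convex_on_imp_convex)
  let ?f = "\<lambda>t. t * (d x - d y) - d (y + t *\<^sub>R (x - y))"
  have "(?f has_real_derivative (d x - d y) - g y \<bullet> (x - y)) (at 0 within {0..1})"
    by (auto intro!: derivative_eq_intros has_gradient_on_segment_derivative[OF assms(2) cQ assms(4,3)])
  moreover have "?f 0 \<le> ?f t" if "t \<in> {0..1}" for t
    using convex_on_segment_le[OF assms(1,4,3) that] by simp
  ultimately have "0 \<le> (d x - d y) - g y \<bullet> (x - y)"
    by (rule real_derivative_nonneg_at_min)
  then show ?thesis by (simp add: Bregman_def)
qed

lemma Bregman_three_point:
  "Bregman d g z u = Bregman d g z p + Bregman d g p u + (g p - g z) \<bullet> (u - p)"
  by (simp add: Bregman_def inner_diff_left inner_diff_right)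

text \<open>Since \<open>\<phi>\<close> need not be differentiable, it is replaced along the segment
  from \<open>p\<close> to \<open>u\<close> by its chord. The chord dominates \<open>\<phi>\<close>
  and agrees with it at \<open>p\<close>, so \<open>p\<close> stays a minimizer on the segment. The
  first-order condition there, rewritten by \<open>Bregman_three_point\<close>, is the
  claim.\<close>

lemma prox_three_point_inequality:
  assumes "has_gradient_on d g Q" "convex_on Q \<phi>"
    and min: "is_arg_min (\<lambda>x. \<phi> x + M * Bregman d g z x) (\<lambda>x. x \<in> Q) p"
    and "u \<in> Q"
  shows "\<phi> p + M * Bregman d g z p + M * Bregman d g p u \<le> \<phi> u + M * Bregman d g z u"
proof -
  have cQ: "convex Q" using assms(2) by (rule convex_on_imp_convex)
  have pQ: "p \<in> Q" using min by (simp add: is_arg_min_def)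
  let ?x = "\<lambda>t. p + t *\<^sub>R (u - p)"
  let ?f = "\<lambda>t. t * (\<phi> u - \<phi> p) + M * Bregman d g z (?x t)"
  \<comment> \<open>The divergence is expanded so that everything except \<open>d\<close> along the
    segment is visibly affine in \<open>t\<close>.\<close>
  have "((\<lambda>t. t * (\<phi> u - \<phi> p)
        + M * (d (?x t) - d z - (g z \<bullet> (p - z) + t * (g z \<bullet> (u - p)))))
      has_real_derivative (\<phi> u - \<phi> p) + M * (g p \<bullet> (u - p) - g z \<bullet> (u - p))) (at 0 within {0..1})"
    by (auto intro!: derivative_eq_intros has_gradient_on_segment_derivative[OF assms(1) cQ pQ assms(4)])
  then have "(?f has_real_derivative (\<phi> u - \<phi> p) + M * (g p \<bullet> (u - p) - g z \<bullet> (u - p)))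
      (at 0 within {0..1})"
    by (simp add: Bregman_def inner_add_right inner_diff_right algebra_simps)
  moreover have "?f 0 \<le> ?f t" if t: "t \<in> {0..1}" for t
  proof -
    have "\<phi> p + M * Bregman d g z p \<le> \<phi> (?x t) + M * Bregman d g z (?x t)"
      using min segment_in_convex[OF cQ pQ assms(4) t]
      by (auto simp: is_arg_min_def not_less)
    then show ?thesis using convex_on_segment_le[OF assms(2) pQ assms(4) t] by simp
  qed
  ultimately have "0 \<le> (\<phi> u - \<phi> p) + M * (g p \<bullet> (u - p) - g z \<bullet> (u - p))"
    by (rule real_derivative_nonneg_at_min)
  then show ?thesis
    unfolding Bregman_three_point[of d g z u p] by (simp add: inner_diff_left algebra_simps)
qed

lemma mirror_prox_step_bound:
  assumes grad: "has_gradient_on d g Q" and model: "vi_model Q (Bregman d g) \<delta> L \<psi>"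
    and step: "mirror_prox_step Q (Bregman d g) \<psi> M z w z'"
    and accept: "mirror_prox_accept (Bregman d g) \<delta> \<psi> M z w z'"
    and "z \<in> Q" "u \<in> Q"
  shows "- \<psi> u w \<le> M * Bregman d g z u - M * Bregman d g z' u + \<delta>"
proof -
  have Q: "w \<in> Q" "z' \<in> Q" using step by (auto simp: mirror_prox_step_def is_arg_min_def)
  have cvx: "convex_on Q (\<lambda>x. \<psi> x y)" if "y \<in> Q" for y
    using model that by (simp add: vi_model_def)
  have "\<psi> w z + M * Bregman d g z w + M * Bregman d g w z' \<le> \<psi> z' z + M * Bregman d g z z'"
    using prox_three_point_inequality[OF grad cvx[OF \<open>z \<in> Q\<close>] _ Q(2)] step
    by (simp add: mirror_prox_step_def)
  moreover have "\<psi> z' w + M * Bregman d g z z' + M * Bregman d g z' u \<le> \<psi> u w + M * Bregman d g z u"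
    using prox_three_point_inequality[OF grad cvx[OF Q(1)] _ \<open>u \<in> Q\<close>] step
    by (simp add: mirror_prox_step_def)
  \<comment> \<open>In the sum of the two bounds \<open>M * Bregman d g z z'\<close> cancels, and
    the acceptance test bounds \<open>\<psi> z' z\<close> by terms that all occur on the left, plus
    \<open>\<delta>\<close>.\<close>
  ultimately show ?thesis
    using accept by (simp add: mirror_prox_accept_def algebra_simps)
qed

text \<open>Condition (iv) of the model, with \<open>w\<close> as intermediate point, is the test
  for the constant \<open>L\<close>; nonnegative divergences allow raising \<open>L\<close> to
  \<open>M\<close>.\<close>

lemma mirror_prox_accept_if_ge:
  assumes model: "vi_model Q V \<delta> L \<psi>"
    and nonneg: "\<And>x y. \<lbrakk>x \<in> Q; y \<in> Q\<rbrakk> \<Longrightarrow> 0 \<le> V y x"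
    and "z \<in> Q" "w \<in> Q" "z' \<in> Q" "L \<le> M"
  shows "mirror_prox_accept V \<delta> \<psi> M z w z'"
proof -
  have "\<psi> z' z \<le> \<psi> z' w + \<psi> w z + L * V w z' + L * V z w + \<delta>"
    using assms by (auto simp: vi_model_def)
  moreover have "L * V w z' \<le> M * V w z'" "L * V z w \<le> M * V z w"
    using assms by (auto intro!: mult_right_mono)
  ultimately show ?thesis by (simp add: mirror_prox_accept_def algebra_simps)
qed

lemma generalized_mirror_prox_in:
  assumes "generalized_mirror_prox Q d V \<delta> \<psi> z w Ls"
  shows "z k \<in> Q" "w k \<in> Q"
proof -
  have "w j \<in> Q \<and> z (Suc j) \<in> Q" for j
    using assms unfolding generalized_mirror_prox_def mirror_prox_step_def is_arg_min_def by blast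
  moreover have "z 0 \<in> Q"
    using assms by (simp add: generalized_mirror_prox_def is_arg_min_def)
  ultimately show "z k \<in> Q" "w k \<in> Q" by (cases k; simp)+
qed

text \<open>If the first trial succeeds, the constant is halved, so \<open>4 * L\<close> becomes at
  most \<open>2 * L\<close>. Otherwise the accepted constant is twice a rejected one, which was
  below \<open>L\<close>. Either way the bound \<open>4 * L\<close> needed for the next step holds
  again.\<close>

lemma generalized_mirror_prox_constants:
  assumes gen: "generalized_mirror_prox Q d V \<delta> \<psi> z w Ls"
    and model: "vi_model Q V \<delta> L \<psi>"
    and nonneg: "\<And>x y. \<lbrakk>x \<in> Q; y \<in> Q\<rbrakk> \<Longrightarrow> 0 \<le> V y x"
    and "L > 0" "Ls 0 > 0" "Ls 0 \<le> 4 * L"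
  shows "Ls (Suc k) > 0 \<and> Ls (Suc k) \<le> 2 * L"
proof -
  have step: "0 < Ls (Suc k) \<and> Ls (Suc k) \<le> 2 * L" if k: "0 < Ls k" "Ls k \<le> 4 * L" for k
  proof -
    obtain i :: nat where i: "Ls (Suc k) = 2 powi (int i - 1) * Ls k"
      and fail: "\<And>j. j < i \<Longrightarrow> \<exists>w' z'. mirror_prox_step Q V \<psi> (2 powi (int j - 1) * Ls k) (z k) w' z' \<and>
           \<not> mirror_prox_accept V \<delta> \<psi> (2 powi (int j - 1) * Ls k) (z k) w' z'"
      using gen unfolding generalized_mirror_prox_def by blast
    have "Ls (Suc k) \<le> 2 * L"
    proof (cases i)
      case 0
      then show ?thesis using i k by (simp add: power_int_minus)
    next
      case (Suc j)
      then obtain w' z' where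
        "mirror_prox_step Q V \<psi> (2 powi (int j - 1) * Ls k) (z k) w' z'"
        "\<not> mirror_prox_accept V \<delta> \<psi> (2 powi (int j - 1) * Ls k) (z k) w' z'"
        using fail[of j] by auto
      moreover from this have "w' \<in> Q" "z' \<in> Q"
        by (simp_all add: mirror_prox_step_def is_arg_min_def)
      ultimately have "2 powi (int j - 1) * Ls k < L"
        using mirror_prox_accept_if_ge[of Q V \<delta> L \<psi> "z k" w' z', OF model nonneg
            generalized_mirror_prox_in(1)[OF gen]] not_le by blast
      moreover have "(2::real) powi (int i - 1) = 2 * 2 powi (int j - 1)"
        using power_int_add[of "2::real" 1 "int j - 1"] Suc by simp
      ultimately show ?thesis using i by simp
    qed
    then show ?thesis using i k by simp
  qed
  show ?thesis
  proof (induction k)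
    case 0
    show ?case using step[of 0] \<open>Ls 0 > 0\<close> \<open>Ls 0 \<le> 4 * L\<close> .
  next
    case (Suc k)
    then show ?case using step[of "Suc k"] \<open>L > 0\<close> by linarith
  qed
qed

lemma has_gradient_on_continuous:
  assumes "has_gradient_on d g Q"
  shows "continuous_on Q d"
  using assms has_derivative_continuous
  unfolding has_gradient_on_def continuous_on_eq_continuous_within by blast

text \<open>Ensures that the supremum in the final bounds really dominates every
  \<open>Bregman d g y u\<close> with \<open>u\<close> in \<open>Q\<close>.\<close>

lemma Bregman_bdd_above:
  assumes "has_gradient_on d g Q" "compact Q"
  shows "bdd_above (Bregman d g y ` Q)"
proof -
  have "continuous_on Q (\<lambda>u. Bregman d g y u)"
    unfolding Bregman_def by (intro continuous_intros has_gradient_on_continuous[OF assms(1)])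
  then show ?thesis
    using assms(2) by (intro bounded_imp_bdd_above compact_imp_bounded compact_continuous_image)
qed

text \<open>\<open>\<psi>\<close> carries no continuity assumption, so maxima are read as suprema;
  the \<open>bdd_above\<close> conjuncts make these meaningful. The search at most halves the
  current constant, so \<open>Ls 0 \<le> 4 * L\<close> is what permits
  \<open>Ls 1 \<le> 2 * L\<close>.\<close>

theorem theorem11:
  fixes Q :: "(real ^ 'n) set"
    and d :: "real ^ 'n \<Rightarrow> real"
    and g :: "real ^ 'n \<Rightarrow> real ^ 'n"
    and \<psi> :: "real ^ 'n \<Rightarrow> real ^ 'n \<Rightarrow> real"
    and \<delta> L :: real
    and z w :: "nat \<Rightarrow> real ^ 'n"
    and Ls :: "nat \<Rightarrow> real"
    and N :: nat
  assumes "convex Q" and "compact Q"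
    and "convex_on Q d" and "has_gradient_on d g Q"
    and "L > 0" and "\<delta> > 0"
    and "vi_model Q (Bregman d g) \<delta> L \<psi>"
    and "generalized_mirror_prox Q d (Bregman d g) \<delta> \<psi> z w Ls"
    and "Ls 0 > 0" and "Ls 0 \<le> 4 * L"
    and "N \<ge> 1"
  shows "bdd_above ((\<lambda>u. - (1 / weight_sum Ls N) * (\<Sum>k<N. \<psi> u (w k) / Ls (Suc k))) ` Q) \<and>
         (SUP u\<in>Q. - (1 / weight_sum Ls N) * (\<Sum>k<N. \<psi> u (w k) / Ls (Suc k)))
           \<le> 2 * L * (SUP u\<in>Q. Bregman d g (z 0) u) / real N + \<delta> \<and>
         bdd_above ((\<lambda>u. \<psi> (weighted_average Ls w N) u) ` Q) \<and>
         (SUP u\<in>Q. \<psi> (weighted_average Ls w N) u)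
           \<le> 2 * L * (SUP u\<in>Q. Bregman d g (z 0) u) / real N + 2 * \<delta>"
proof -
  let ?V = "Bregman d g"
  let ?S = "weight_sum Ls N"
  let ?gap = "\<lambda>u. - (1 / ?S) * (\<Sum>k<N. \<psi> u (w k) / Ls (Suc k))"
  let ?R = "SUP u\<in>Q. ?V (z 0) u"
  note grad = \<open>has_gradient_on d g Q\<close> and model = \<open>vi_model Q ?V \<delta> L \<psi>\<close>
  note gen = \<open>generalized_mirror_prox Q d ?V \<delta> \<psi> z w Ls\<close>
  note inQ = generalized_mirror_prox_in[OF gen]
  have nonneg: "0 \<le> ?V y x" if "x \<in> Q" "y \<in> Q" for x y
    using Bregman_nonneg[OF \<open>convex_on Q d\<close> grad that] .
  have Ls: "Ls (Suc k) > 0" "Ls (Suc k) \<le> 2 * L" for k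
    using generalized_mirror_prox_constants[OF gen model nonneg \<open>L > 0\<close> \<open>Ls 0 > 0\<close> \<open>Ls 0 \<le> 4 * L\<close>]
    by auto
  have "(\<Sum>k<N. 1 / (2 * L)) \<le> ?S"
    unfolding weight_sum_def by (intro sum_mono divide_left_mono) (use Ls \<open>L > 0\<close> in auto)
  then have S: "real N / (2 * L) \<le> ?S" by simp
  have "0 < real N / (2 * L)" using \<open>N \<ge> 1\<close> \<open>L > 0\<close> by simp
  then have S0: "?S > 0" using S by linarith
  have V0: "?V (z 0) u \<le> ?R" if "u \<in> Q" for u
    using cSUP_upper[OF that Bregman_bdd_above[OF grad \<open>compact Q\<close>]] .
  have gap: "?gap u \<le> 2 * L * ?R / real N + \<delta>" if u: "u \<in> Q" for u
  proof -
    have "- (\<psi> u (w k) / Ls (Suc k)) \<le> (?V (z k) u - ?V (z (Suc k)) u) + \<delta> * (1 / Ls (Suc k))" for k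
    proof -
      have "- \<psi> u (w k) \<le> Ls (Suc k) * ?V (z k) u - Ls (Suc k) * ?V (z (Suc k)) u + \<delta>"
        using gen mirror_prox_step_bound[OF grad model _ _ inQ(1) u]
        unfolding generalized_mirror_prox_def by blast
      then show ?thesis using Ls(1)[of k] by (simp add: field_simps)
    qed
    then have "(\<Sum>k<N. - (\<psi> u (w k) / Ls (Suc k)))
        \<le> (\<Sum>k<N. (?V (z k) u - ?V (z (Suc k)) u) + \<delta> * (1 / Ls (Suc k)))"
      by (intro sum_mono)
    also have "\<dots> = ?V (z 0) u - ?V (z N) u + \<delta> * ?S"
      unfolding sum.distrib weight_sum_def sum_distrib_left
      using sum_lessThan_telescope'[of "\<lambda>k. ?V (z k) u" N] by simp
    also have "\<dots> \<le> ?R + \<delta> * ?S"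
      using V0[OF u] nonneg[OF u inQ(1), of N] by simp
    finally have "?gap u \<le> ?R / ?S + \<delta>"
      using S0 by (simp add: sum_negf field_simps)
    \<comment> \<open>Shrinking the denominator needs \<open>?R\<close> nonnegative, which follows
      from \<open>0 \<le> ?V (z 0) u \<le> ?R\<close>.\<close>
    also have "?R / ?S \<le> ?R / (real N / (2 * L))"
      using V0[OF u] nonneg[OF u inQ(1), of 0] S S0 \<open>N \<ge> 1\<close> \<open>L > 0\<close>
      by (intro divide_left_mono) auto
    finally show ?thesis by (simp add: mult_ac)
  qed
  \<comment> \<open>Jensen's inequality in the first argument comes first. Condition (iii) then
    swaps the arguments, which costs the second \<open>\<delta>\<close> and leaves
    \<open>?gap u\<close>.\<close>
  have avg: "\<psi> (weighted_average Ls w N) u \<le> 2 * L * ?R / real N + 2 * \<delta>" if u: "u \<in> Q" for u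
  proof -
    let ?a = "\<lambda>k. 1 / ?S * (1 / Ls (Suc k))"
    have sum_a: "(\<Sum>k<N. ?a k) = 1"
      unfolding sum_distrib_left[symmetric] using S0 by (simp add: weight_sum_def)
    have a0: "?a k \<ge> 0" for k using S0 Ls(1)[of k] by simp
    have "weighted_average Ls w N = (\<Sum>k<N. ?a k *\<^sub>R w k)"
      unfolding weighted_average_def by (simp add: scaleR_sum_right)
    then have "\<psi> (weighted_average Ls w N) u \<le> (\<Sum>k<N. ?a k * \<psi> (w k) u)"
      using convex_on_sum[where f = "\<lambda>x. \<psi> x u" and S = "{..<N}" and C = Q and a = ?a and y = w]
        model u sum_a a0 inQ(2) \<open>N \<ge> 1\<close>
      by (auto simp: vi_model_def lessThan_empty_iff)
    also have "\<dots> \<le> (\<Sum>k<N. ?a k * (\<delta> - \<psi> u (w k)))"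
    proof (intro sum_mono mult_left_mono a0)
      fix k
      have "\<psi> (w k) u + \<psi> u (w k) \<le> \<delta>" using model u inQ(2) by (simp add: vi_model_def)
      then show "\<psi> (w k) u \<le> \<delta> - \<psi> u (w k)" by simp
    qed
    also have "\<dots> = (\<Sum>k<N. ?a k) * \<delta> + ?gap u"
      by (simp add: right_diff_distrib sum_subtractf sum_negf sum_distrib_left sum_distrib_right)
    finally show ?thesis using gap[OF u] sum_a by simp
  qed
  have "Q \<noteq> {}" using inQ(1) by blast
  then show ?thesis
    using gap avg by (intro conjI bdd_aboveI2 cSUP_least)
qed

end
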